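(* Let $\mathfrak{C}$ be a covariance model and suppose that $\operatorname{span}(J(\mathfrak{C}))\cap\mathfrak{M}\subseteq\mathfrak{M}_0-\mu_0$ (where $\mu_0\in\mathfrak{M}_0$). 1. Let $\bar{\mathfrak{M}}$ be the linear space spanned by $J(\mathfrak{C})\cup\mathfrak{M}$. Let $\bar X=(X,\bar x_1,\dots,\bar x_p)$, where $\bar x_i\in\operatorname{span}(J(\mathfrak{C})\cup(\mathfrak{M}_0-\mu_0))$ are chosen such that the columns of $\bar X$ form a basis of $\bar{\mathfrak{M}}$. Assume $k<k+p<n$. Suppose $\bar\theta$ and $\bar\Omega$ are estimators forming a regular equivariant pair relative to $\bar X$ with exceptional set $\bar N$ (see context), and let $\bar N^*=\bar N\cup\{y\in\mathbb{R}^n\setminus\bar N:\det\bar\Omega(y)=0\}$. Define $\bar\beta=(I_k,0)\bar\theta$. Then $\bar\beta$ and $\bar\Omega$ form a regular equivariant pair relative to $X$ with exceptional set $\bar N$, and the test statistic $\bar T$ given by $$\bar T(y)=\begin{cases}(R\bar\beta(y)-r)'\bar\Omega^{-1}(y)(R\bar\beta(y)-r),&y\in\mathbb{R}^n\setminus\bar N^*,\\0,&y\in\bar N^*,\end{cases}$$ satisfies $\bar T(y+z)=\bar T(y)$ for every $y\in\mathbb{R}^n$ and every $z\in J(\mathfrak{C})$. 2. Let $\bar{\mathfrak{M}}$ and $\bar X$ be as in item 1 and $k<k+p<n$. Suppose $\bar\theta(y)=(\bar X'\bar X)^{-1}\bar X'y$ is the least squares estimator based on $\bar X$, and $\bar\beta=(I_k,0)\bar\theta$.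 Then the requirements on $\bar\theta$ in the definition of a regular equivariant pair relative to $\bar X$ (well-definedness, continuity, and equivariance) are satisfied, and $R\bar\beta(z)=0$ for every $z\in\operatorname{span}(J(\mathfrak{C}))$. Furthermore, if $X^*=(X,x_1^*,\dots,x_p^* )$ is obtained in the same way as $\bar X$ but for another choice of elements $x_i^*\in\operatorname{span}(J(\mathfrak{C})\cup(\mathfrak{M}_0-\mu_0))$ and $\theta^*$ denotes the least squares estimator with respect to the design matrix $X^*$, then $R\bar\beta(y)=R\beta^*(y)$ for every $y\in\mathbb{R}^n$, where $\beta^*=(I_k,0)\theta^*$.
   Context: Framework: $n,k,q$ are integers with $1\le k<n$, $q\ge1$; $X$ is a fixed real $n\times k$ matrix of rank $k$; $R$ is a fixed real $q\times k$ matrix of rank $q$; $r\in\mathbb{R}^q$. A covariance model $\mathfrak{C}$ is a nonempty set of symmetric positive definite $n\times n$ matrices such that $\sigma^2\in(0,\infty)$ and $\Sigma\in\mathfrak{C}$ are uniquely determined by $\sigma^2\Sigma$. $\mathfrak{M}=\operatorname{span}(X)$, $\mathfrak{M}_0=\{X\beta:\beta\in\mathbb{R}^k,\ R\beta=r\}$; $\mathfrak{M}_0-\mu_0$ is a linear space that does not depend on the choice of $\mu_0\in\mathfrak{M}_0$. $I_k$ is the $k\times k$ identity matrix; $\lambda_{\mathbb{R}^n}$ is Lebesgue measure. $J(\mathfrak{C})=\bigcup\{\operatorname{span}(\bar\Sigma):\det\bar\Sigma=0,\ \bar\Sigma=\lim_{m\to\infty}\Sigma_m\text{ for a sequence }\Sigma_m\in\mathfrak{C}\}$;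 $\operatorname{span}$ of a matrix is its column space, $\operatorname{span}$ of a set its linear hull. Regular equivariant pair relative to an $n\times\kappa$ matrix $\mathsf{X}$ of full column rank $\kappa$, with exceptional set $N$: (i) $\vartheta:\mathbb{R}^n\setminus N\to\mathbb{R}^\kappa$ and $\Omega:\mathbb{R}^n\setminus N\to\mathbb{R}^{q\times q}$ are well-defined and continuous on the complement of a closed $\lambda_{\mathbb{R}^n}$-null set $N$, and $\Omega$ is symmetric there; (ii) $y\in\mathbb{R}^n\setminus N$ implies $\alpha y+\mathsf{X}\eta\in\mathbb{R}^n\setminus N$ for all $\alpha\ne0$, $\eta\in\mathbb{R}^\kappa$; (iii) $\vartheta(\alpha y+\mathsf{X}\eta)=\alpha\vartheta(y)+\eta$ and $\Omega(\alpha y+\mathsf{X}\eta)=\alpha^2\Omega(y)$ for all $y\in\mathbb{R}^n\setminus N$, $\alpha\ne0$, $\eta\in\mathbb{R}^\kappa$; (iv) $\Omega$ is nonsingular $\lambda_{\mathbb{R}^n}$-almost everywhere on $\mathbb{R}^n\setminus N$. (Used with $\mathsf{X}=\bar X$, $\kappa=k+p$, $\vartheta=\bar\theta$ and with $\mathsf{X}=X$, $\kappa=k$, $\vartheta=\bar\beta$.) *)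

theory Defs
  imports "HOL-Analysis.Analysis"
begin

definition pos_def :: "real^'n^'n \<Rightarrow> bool" where
  "pos_def S \<longleftrightarrow> (\<forall>x. x \<noteq> 0 \<longrightarrow> x \<bullet> (S *v x) > 0)"

text \<open>The scalars \<open>s\<close> and \<open>t\<close> play the role of the variance parameter \<open>\<sigma>\<^sup>2\<close>.\<close>

definition covariance_model :: "(real^'n^'n) set \<Rightarrow> bool" where
  "covariance_model C \<longleftrightarrow>
     C \<noteq> {} \<and>
     (\<forall>S\<in>C. transpose S = S \<and> pos_def S) \<and>
     (\<forall>s t. \<forall>S\<in>C. \<forall>T\<in>C. s > 0 \<longrightarrow> t > 0 \<longrightarrow> s *\<^sub>R S = t *\<^sub>R T \<longrightarrow> s = t \<and> S = T)"

definition col_space :: "real^'k^'n \<Rightarrow> (real^'n) set" where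
  "col_space A = span (columns A)"

definition restricted_space :: "real^'k^'n \<Rightarrow> real^'k^'q \<Rightarrow> real^'q \<Rightarrow> (real^'n) set" where
  "restricted_space X R r = {X *v \<beta> | \<beta>. R *v \<beta> = r}"

definition restricted_space_diff ::
    "real^'k^'n \<Rightarrow> real^'k^'q \<Rightarrow> real^'q \<Rightarrow> real^'n \<Rightarrow> (real^'n) set" where
  "restricted_space_diff X R r \<mu>\<^sub>0 = {\<mu> - \<mu>\<^sub>0 | \<mu>. \<mu> \<in> restricted_space X R r}"

definition J_set :: "(real^'n^'n) set \<Rightarrow> (real^'n) set" where
  "J_set C = \<Union> {col_space S | S. det S = 0 \<and>
      (\<exists>\<Sigma>. (\<forall>m::nat. \<Sigma> m \<in> C) \<and> \<Sigma> \<longlonglongrightarrow> S)}"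

definition M_bar :: "(real^'n^'n) set \<Rightarrow> real^'k^'n \<Rightarrow> (real^'n) set" where
  "M_bar C X = span (J_set C \<union> col_space X)"

text \<open>The block matrix \<open>(A, B)\<close>; its columns are indexed by the disjoint sum of the index types.\<close>

definition append_cols :: "real^'k^'n \<Rightarrow> real^'p^'n \<Rightarrow> real^('k + 'p)^'n" where
  "append_cols A B = (\<chi> i j. case j of Inl a \<Rightarrow> A $ i $ a | Inr b \<Rightarrow> B $ i $ b)"

text \<open>Since \<open>columns A\<close> is a set, injectivity is needed to exclude repeated columns.\<close>

definition columns_basis :: "real^'k^'n \<Rightarrow> (real^'n) set \<Rightarrow> bool" where
  "columns_basis A V \<longleftrightarrow>
     inj (\<lambda>j. column j A) \<and> independent (columns A) \<and> span (columns A) = V"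

text \<open>The added regressors are the columns of \<open>B\<close>.\<close>

definition admissible_extension ::
    "(real^'n^'n) set \<Rightarrow> real^'k^'n \<Rightarrow> real^'k^'q \<Rightarrow> real^'q \<Rightarrow> real^'n \<Rightarrow> real^'p^'n \<Rightarrow> bool" where
  "admissible_extension C X R r \<mu>\<^sub>0 B \<longleftrightarrow>
     (\<forall>i. column i B \<in> span (J_set C \<union> restricted_space_diff X R r \<mu>\<^sub>0)) \<and>
     columns_basis (append_cols X B) (M_bar C X)"

text \<open>Functions on the complement of \<open>N\<close> are represented by total functions about which
  nothing is required on \<open>N\<close>.\<close>

definition exceptional_set :: "real^'k^'n \<Rightarrow> (real^'n) set \<Rightarrow> bool" where
  "exceptional_set A N \<longleftrightarrow>
     closed N \<and> N \<in> null_sets lebesgue \<and>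
     (\<forall>y \<alpha> \<eta>. y \<notin> N \<longrightarrow> \<alpha> \<noteq> 0 \<longrightarrow> \<alpha> *\<^sub>R y + A *v \<eta> \<notin> N)"

definition regular_equivariant_estimator ::
    "real^'k^'n \<Rightarrow> (real^'n) set \<Rightarrow> (real^'n \<Rightarrow> real^'k) \<Rightarrow> bool" where
  "regular_equivariant_estimator A N \<theta> \<longleftrightarrow>
     continuous_on (- N) \<theta> \<and>
     (\<forall>y \<alpha> \<eta>. y \<notin> N \<longrightarrow> \<alpha> \<noteq> 0 \<longrightarrow> \<theta> (\<alpha> *\<^sub>R y + A *v \<eta>) = \<alpha> *\<^sub>R \<theta> y + \<eta>)"

definition regular_equivariant_pair ::
    "real^'k^'n \<Rightarrow> (real^'n) set \<Rightarrow> (real^'n \<Rightarrow> real^'k) \<Rightarrow> (real^'n \<Rightarrow> real^'q^'q) \<Rightarrow> bool" where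
  "regular_equivariant_pair A N \<theta> \<Omega> \<longleftrightarrow>
     rank A = CARD('k) \<and>
     exceptional_set A N \<and>
     regular_equivariant_estimator A N \<theta> \<and>
     continuous_on (- N) \<Omega> \<and>
     (\<forall>y. y \<notin> N \<longrightarrow> transpose (\<Omega> y) = \<Omega> y) \<and>
     (\<forall>y \<alpha> \<eta>. y \<notin> N \<longrightarrow> \<alpha> \<noteq> 0 \<longrightarrow> \<Omega> (\<alpha> *\<^sub>R y + A *v \<eta>) = \<alpha>\<^sup>2 *\<^sub>R \<Omega> y) \<and>
     (AE y in lebesgue. y \<notin> N \<longrightarrow> invertible (\<Omega> y))"

definition N_star :: "(real^'n) set \<Rightarrow> (real^'n \<Rightarrow> real^'q^'q) \<Rightarrow> (real^'n) set" where
  "N_star N \<Omega> = N \<union> {y. y \<notin> N \<and> det (\<Omega> y) = 0}"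

definition test_statistic ::
    "real^'k^'q \<Rightarrow> real^'q \<Rightarrow> (real^'n) set \<Rightarrow> (real^'n \<Rightarrow> real^'k) \<Rightarrow> (real^'n \<Rightarrow> real^'q^'q)
      \<Rightarrow> real^'n \<Rightarrow> real" where
  "test_statistic R r N \<beta> \<Omega> y =
     (if y \<in> N_star N \<Omega> then 0
      else (R *v \<beta> y - r) \<bullet> (matrix_inv (\<Omega> y) *v (R *v \<beta> y - r)))"

definition ls_estimator :: "real^'k^'n \<Rightarrow> real^'n \<Rightarrow> real^'k" where
  "ls_estimator A y = matrix_inv (transpose A ** A) *v (transpose A *v y)"

text \<open>\<open>first_block \<theta>\<close> is \<open>(I\<^sub>k, 0) \<theta>\<close>.\<close>

definition first_block :: "(real^'n \<Rightarrow> real^('k + 'p::finite)) \<Rightarrow> real^'n \<Rightarrow> real^'k" where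
  "first_block \<theta> y = append_cols (mat 1) 0 *v \<theta> y"

end

theory Submission
  imports Defs
begin

text \<open>
  Let \<open>D\<close> be the linear space \<open>\<MM>\<^sub>0 - \<mu>\<^sub>0 = {X \<beta> | R \<beta> = 0}\<close> and let \<open>L\<close> be the span of
  \<open>J \<union> D\<close>.  Both items rest on one observation (lemma
  \<open>restriction_vanishes_on_enlarged_span\<close>): if \<open>X g + B h\<close> lies in \<open>L\<close>, then \<open>R g = 0\<close>.  The
  columns of \<open>B\<close>, the additional regressors, lie in \<open>L\<close>, so \<open>X g\<close> does as well; writing
  \<open>X g = j + d\<close> with \<open>j\<close> in
  \<open>span J\<close> and \<open>d\<close> in \<open>D\<close>, the vector \<open>j = X g - d\<close> lies in \<open>span J \<inter> \<MM>\<close>, hence in \<open>D\<close> by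
  hypothesis.  Thus \<open>X g\<close> is in \<open>D\<close>, and injectivity of \<open>X\<close> gives \<open>R g = 0\<close>.

  For the first item, adding \<open>z \<in> J\<close> to \<open>y\<close> is a shift by \<open>(X, B) \<gamma>\<close>.  By equivariance it leaves
  \<open>\<Omega>\<close> and the exceptional set alone and adds \<open>\<gamma>\<close> to the estimator, and the observation says that
  \<open>R\<close> annihilates the first block of \<open>\<gamma>\<close>.

  For the second item, least squares returns \<open>\<gamma>\<close> on \<open>z = (X, B) \<gamma>\<close>, so the observation applies
  again.  Together with \<open>X\<close>, any two choices of additional regressors span the same space, so
  their fitted values agree,
  being the orthogonal projection of \<open>y\<close>; the difference of the two \<open>X\<close>-components of the fit
  is then a combination of additional regressors, which lies in \<open>L\<close>.
\<close>

section \<open>Block matrices and the linear part of the null hypothesis\<close>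

lemma append_cols_mult:
  fixes A :: "real^'k^'n" and B :: "real^'p^'n"
  shows "append_cols A B *v \<gamma> = A *v (\<chi> a. \<gamma> $ Inl a) + B *v (\<chi> b. \<gamma> $ Inr b)"
proof -
  have "(\<Sum>j\<in>UNIV. f j) = (\<Sum>a\<in>UNIV. f (Inl a)) + (\<Sum>b\<in>UNIV. f (Inr b))"
    for f :: "'k + 'p \<Rightarrow> real"
    by (simp add: UNIV_Plus_UNIV[symmetric] sum.Plus del: UNIV_Plus_UNIV)
  then show ?thesis
    by (simp add: append_cols_def matrix_vector_mult_def vec_eq_iff)
qed

lemma head_block_mult:
  fixes \<gamma> :: "real^('k::finite + 'p::finite)"
  shows "(append_cols (mat 1) 0 :: real^('k + 'p)^'k) *v \<gamma> = (\<chi> a. \<gamma> $ Inl a)"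
  by (simp add: append_cols_mult)

lemma append_cols_mult_head:
  fixes X :: "real^'k^'n" and B :: "real^'p^'n"
  shows "append_cols X B *v (\<chi> j. case j of Inl a \<Rightarrow> \<eta> $ a | Inr b \<Rightarrow> 0) = X *v \<eta>"
proof -
  have "(\<chi> b. (0::real)) = (0 :: real^'p)"
    by (simp add: vec_eq_iff)
  then show ?thesis
    by (simp add: append_cols_mult)
qed

lemma col_space_eq_range: "col_space A = range ((*v) A)"
proof
  have "subspace (range ((*v) A))"
    by (intro linear_subspace_image) auto
  moreover have "columns A \<subseteq> range ((*v) A)"
    by (auto simp: columns_def matrix_vector_mult_basis[symmetric])
  ultimately show "col_space A \<subseteq> range ((*v) A)"
    by (auto simp: col_space_def intro: span_minimal[THEN subsetD])
qed (auto simp: col_space_def matrix_vector_mult_in_columnspace)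

lemma columns_basis_inj:
  fixes A :: "real^'k^'n"
  assumes "columns_basis A V"
  shows "inj ((*v) A)"
proof -
  have "columns A = range (\<lambda>j. column j A)"
    by (auto simp: columns_def)
  then have "card (columns A) = CARD('k)"
    using assms by (simp add: columns_basis_def card_image)
  moreover have "dim (columns A) = card (columns A)"
    using assms by (simp add: columns_basis_def dim_eq_card_independent)
  ultimately show ?thesis
    by (simp add: full_rank_injective[symmetric] column_rank_def)
qed

lemma restricted_space_diff_eq:
  assumes "\<mu> \<in> restricted_space X R r"
  shows "restricted_space_diff X R r \<mu> = (*v) X ` {\<beta>. R *v \<beta> = 0}"
proof -
  obtain b where b: "\<mu> = X *v b" "R *v b = r"
    using assms by (auto simp: restricted_space_def)
  show ?thesis
  proof (intro set_eqI iffI)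
    fix x assume "x \<in> restricted_space_diff X R r \<mu>"
    then obtain \<beta> where "x = X *v \<beta> - \<mu>" "R *v \<beta> = r"
      by (auto simp: restricted_space_diff_def restricted_space_def)
    then have "x = X *v (\<beta> - b)" "R *v (\<beta> - b) = 0"
      using b by (simp_all add: matrix_vector_mult_diff_distrib)
    then show "x \<in> (*v) X ` {\<beta>. R *v \<beta> = 0}"
      by blast
  next
    fix x assume "x \<in> (*v) X ` {\<beta>. R *v \<beta> = 0}"
    then obtain \<beta> where "x = X *v \<beta>" "R *v \<beta> = 0"
      by blast
    then have "x = X *v (b + \<beta>) - \<mu>" "R *v (b + \<beta>) = r"
      using b by (simp_all add: matrix_vector_right_distrib)
    then show "x \<in> restricted_space_diff X R r \<mu>"
      unfolding restricted_space_diff_def restricted_space_def by blast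
  qed
qed

lemma subspace_restricted_space_diff:
  assumes "\<mu> \<in> restricted_space X R r"
  shows "subspace (restricted_space_diff X R r \<mu>)"
proof -
  have "subspace {\<beta>. R *v \<beta> = 0}"
    by (auto simp: subspace_def matrix_vector_right_distrib matrix_vector_mult_scaleR)
  then show ?thesis
    unfolding restricted_space_diff_eq[OF assms]
    by (intro linear_subspace_image) auto
qed

section \<open>The restriction on the enlarged span\<close>

text \<open>
  Both \<open>X g\<close> and the linear part of the null hypothesis lie in \<open>col_space X\<close>, so splitting \<open>X g\<close>
  along \<open>J\<close> and that linear part leaves a \<open>J\<close>-component which is again in \<open>col_space X\<close>.  The
  inclusion for \<open>span J \<inter> col_space X\<close> then places it in the linear part.
\<close>

lemma restriction_vanishes_on_enlarged_span:
  fixes X :: "real^'k^'n" and B :: "real^'p^'n"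
  assumes inj: "inj ((*v) X)"
    and \<mu>: "\<mu> \<in> restricted_space X R r"
    and J: "span J \<inter> col_space X \<subseteq> restricted_space_diff X R r \<mu>"
    and B: "\<And>i. column i B \<in> span (J \<union> restricted_space_diff X R r \<mu>)"
    and mem: "X *v g + B *v h \<in> span (J \<union> restricted_space_diff X R r \<mu>)"
  shows "R *v g = 0"
proof -
  let ?D = "restricted_space_diff X R r \<mu>"
  have D: "subspace ?D"
    using \<mu> by (rule subspace_restricted_space_diff)
  have "B *v h \<in> span (J \<union> ?D)"
    unfolding matrix_mult_sum
    by (intro span_sum) (auto simp: scalar_mult_eq_scaleR intro: span_scale B)
  then have "X *v g \<in> span (J \<union> ?D)"
    using mem span_diff by fastforce
  then obtain j d where jd: "X *v g = j + d" "j \<in> span J" "d \<in> ?D"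
    using D by (auto simp: span_Un span_eq_iff[THEN iffD2])
  then obtain b where "d = X *v b"
    by (auto simp: restricted_space_diff_eq[OF \<mu>])
  then have "j = X *v (g - b)"
    using jd by (simp add: matrix_vector_mult_diff_distrib algebra_simps)
  then have "j \<in> ?D"
    using jd J by (auto simp: col_space_eq_range)
  then have "X *v g \<in> ?D"
    using jd D by (simp add: subspace_add)
  then show ?thesis
    using inj by (auto simp: restricted_space_diff_eq[OF \<mu>] dest: injD)
qed

section \<open>Passing from the enlarged design to the original one\<close>

text \<open>
  Shifts by \<open>X \<eta>\<close> are the shifts by \<open>(X, B) \<gamma>\<close> with \<open>\<gamma> = (\<eta>, 0)\<close>, so equivariance relative to
  the enlarged design specialises to the original one.
\<close>

lemma regular_equivariant_pair_first_block:
  fixes X :: "real^'k^'n" and B :: "real^'p^'n"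
  assumes rank: "rank X = CARD('k)"
    and pair: "regular_equivariant_pair (append_cols X B) N \<theta> \<Omega>"
  shows "regular_equivariant_pair X N (first_block \<theta>) \<Omega>"
proof -
  define e :: "real^'k \<Rightarrow> real^('k + 'p)"
    where "e \<eta> = (\<chi> j. case j of Inl a \<Rightarrow> \<eta> $ a | Inr b \<Rightarrow> 0)" for \<eta>
  have Xe: "X *v \<eta> = append_cols X B *v e \<eta>" for \<eta>
    by (simp add: e_def append_cols_mult_head)
  have head: "(append_cols (mat 1) 0 :: real^('k + 'p)^'k) *v e \<eta> = \<eta>" for \<eta>
    by (simp add: e_def head_block_mult)
  have "continuous_on (- N) \<theta>"
    using pair by (simp add: regular_equivariant_pair_def regular_equivariant_estimator_def)
  then have cont: "continuous_on (- N) (first_block \<theta>)"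
    unfolding first_block_def[abs_def]
    by (rule bounded_linear.continuous_on[OF matrix_vector_mul_bounded_linear])
  have "first_block \<theta> (\<alpha> *\<^sub>R y + X *v \<eta>) = \<alpha> *\<^sub>R first_block \<theta> y + \<eta>"
    if "y \<notin> N" "\<alpha> \<noteq> 0" for y \<alpha> \<eta>
  proof -
    have "\<theta> (\<alpha> *\<^sub>R y + X *v \<eta>) = \<alpha> *\<^sub>R \<theta> y + e \<eta>"
      using pair that unfolding Xe
      by (simp add: regular_equivariant_pair_def regular_equivariant_estimator_def)
    then show ?thesis
      by (simp add: first_block_def matrix_vector_right_distrib matrix_vector_mult_scaleR head)
  qed
  with cont have "regular_equivariant_estimator X N (first_block \<theta>)"
    by (simp add: regular_equivariant_estimator_def)
  moreover have "exceptional_set X N"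
    using pair by (simp add: regular_equivariant_pair_def exceptional_set_def Xe)
  moreover have "\<Omega> (\<alpha> *\<^sub>R y + X *v \<eta>) = \<alpha>\<^sup>2 *\<^sub>R \<Omega> y" if "y \<notin> N" "\<alpha> \<noteq> 0" for y \<alpha> \<eta>
    using pair that by (simp add: regular_equivariant_pair_def Xe)
  ultimately show ?thesis
    using rank pair by (simp add: regular_equivariant_pair_def)
qed

text \<open>
  A shift inside the enlarged column space leaves \<open>\<Omega>\<close> unchanged, so it affects the statistic only
  through \<open>R \<beta>\<close>, to which it adds \<open>R\<close> times the first block of its coefficients.
\<close>

lemma test_statistic_shift_invariant:
  fixes X :: "real^'k^'n" and B :: "real^'p^'n"
  assumes pair: "regular_equivariant_pair (append_cols X B) N \<theta> \<Omega>"
    and R: "R *v (\<chi> a. \<gamma> $ Inl a) = 0"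
  shows "test_statistic R r N (first_block \<theta>) \<Omega> (y + append_cols X B *v \<gamma>)
       = test_statistic R r N (first_block \<theta>) \<Omega> y"
proof -
  let ?A = "append_cols X B"
  have shift: "u + ?A *v g \<notin> N" "\<theta> (u + ?A *v g) = \<theta> u + g" "\<Omega> (u + ?A *v g) = \<Omega> u"
    if "u \<notin> N" for u g
  proof -
    have "1 *\<^sub>R u + ?A *v g \<notin> N" "\<theta> (1 *\<^sub>R u + ?A *v g) = 1 *\<^sub>R \<theta> u + g"
      "\<Omega> (1 *\<^sub>R u + ?A *v g) = 1\<^sup>2 *\<^sub>R \<Omega> u"
      using pair that one_neq_zero
      unfolding regular_equivariant_pair_def regular_equivariant_estimator_def
        exceptional_set_def
      by blast+
    then show "u + ?A *v g \<notin> N" "\<theta> (u + ?A *v g) = \<theta> u + g" "\<Omega> (u + ?A *v g) = \<Omega> u"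
      by simp_all
  qed
  show ?thesis
  proof (cases "y \<in> N")
    case True
    \<comment> \<open>The shift by \<open>-\<gamma>\<close> shows that a shift cannot leave the exceptional set.\<close>
    then have "y + ?A *v \<gamma> \<in> N"
      using shift(1)[of "y + ?A *v \<gamma>" "- \<gamma>"] by (auto simp: vec.neg)
    with True show ?thesis
      by (simp add: test_statistic_def N_star_def)
  next
    case False
    have "R *v first_block \<theta> (y + ?A *v \<gamma>) = R *v first_block \<theta> y"
      using False R
      by (simp add: first_block_def shift matrix_vector_right_distrib head_block_mult)
    with False show ?thesis
      by (simp add: test_statistic_def N_star_def shift)
  qed
qed

section \<open>Least squares\<close>

lemma matrix_inv_both_sides:
  fixes M :: "real^'k^'k"
  assumes "invertible M"
  shows "M ** matrix_inv M = mat 1" and "matrix_inv M ** M = mat 1"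
  using someI_ex[OF assms[unfolded invertible_def]] by (simp_all add: matrix_inv_def)

lemma gram_invertible:
  fixes A :: "real^'k^'n"
  assumes "inj ((*v) A)"
  shows "invertible (transpose A ** A)"
proof -
  have "x = 0" if "(transpose A ** A) *v x = 0" for x
  proof -
    have "(A *v x) \<bullet> (A *v x) = x \<bullet> ((transpose A ** A) *v x)"
      by (metis dot_lmul_matrix inner_commute matrix_vector_mul_assoc transpose_matrix_vector)
    then have "A *v x = A *v 0"
      using that by simp
    then show ?thesis
      using assms by (simp only: inj_eq)
  qed
  then show ?thesis
    by (simp add: invertible_left_inverse matrix_left_invertible_ker)
qed

lemma normal_equations:
  fixes A :: "real^'k^'n"
  assumes "inj ((*v) A)"
  shows "transpose A *v (A *v ls_estimator A y) = transpose A *v y"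
  using matrix_inv_both_sides(1)[OF gram_invertible[OF assms]]
  by (metis ls_estimator_def matrix_vector_mul_assoc matrix_vector_mul_lid)

lemma ls_estimator_shift:
  fixes A :: "real^'k^'n"
  assumes "inj ((*v) A)"
  shows "ls_estimator A (\<alpha> *\<^sub>R y + A *v \<eta>) = \<alpha> *\<^sub>R ls_estimator A y + \<eta>"
proof -
  have "matrix_inv (transpose A ** A) *v (transpose A *v (A *v \<eta>)) = \<eta>"
    using matrix_inv_both_sides(2)[OF gram_invertible[OF assms]]
    by (metis matrix_vector_mul_assoc matrix_vector_mul_lid)
  then show ?thesis
    by (simp add: ls_estimator_def matrix_vector_right_distrib matrix_vector_mult_scaleR
        del: transpose_matrix_vector)
qed

lemma ls_estimator_fitted:
  fixes A :: "real^'k^'n"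
  assumes "inj ((*v) A)"
  shows "ls_estimator A (A *v \<gamma>) = \<gamma>"
  using ls_estimator_shift[OF assms, of 0 0 \<gamma>] by simp

lemma ls_regular_equivariant:
  fixes A :: "real^'k^'n"
  assumes "inj ((*v) A)"
  shows "regular_equivariant_estimator A {} (ls_estimator A)"
proof -
  have "ls_estimator A = (*v) (matrix_inv (transpose A ** A) ** transpose A)"
    by (simp add: fun_eq_iff ls_estimator_def matrix_vector_mul_assoc
        del: transpose_matrix_vector)
  then have "continuous_on (- {}) (ls_estimator A)"
    by (simp add: matrix_vector_mult_linear_continuous_on)
  then show ?thesis
    using ls_estimator_shift[OF assms] by (simp add: regular_equivariant_estimator_def)
qed

lemma ls_residual_orthogonal:
  fixes A :: "real^'k^'n"
  assumes "inj ((*v) A)" and "v \<in> col_space A"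
  shows "v \<bullet> (y - A *v ls_estimator A y) = 0"
proof -
  obtain x where x: "v = A *v x"
    using assms(2) by (auto simp: col_space_eq_range)
  have "v \<bullet> (y - A *v ls_estimator A y)
      = x \<bullet> (transpose A *v (y - A *v ls_estimator A y))"
    unfolding x by (metis dot_lmul_matrix inner_commute transpose_matrix_vector)
  then show ?thesis
    by (simp add: matrix_vector_mult_diff_distrib normal_equations[OF assms(1)]
        del: transpose_matrix_vector)
qed

text \<open>
  The difference of the two fits lies in the common column space; it is also the difference of
  two residuals, hence orthogonal to that space and to itself.
\<close>

lemma ls_fit_depends_on_col_space:
  fixes A :: "real^'k^'n" and A' :: "real^'l^'n"
  assumes "inj ((*v) A)" "inj ((*v) A')" and eq: "col_space A = col_space A'"
  shows "A *v ls_estimator A y = A' *v ls_estimator A' y"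
proof -
  define w where "w = A *v ls_estimator A y - A' *v ls_estimator A' y"
  have "A *v ls_estimator A y \<in> col_space A" "A' *v ls_estimator A' y \<in> col_space A"
    using eq by (metis col_space_eq_range rangeI)+
  then have w: "w \<in> col_space A"
    unfolding w_def col_space_def by (rule span_diff)
  have "w \<bullet> w = w \<bullet> (y - A' *v ls_estimator A' y) - w \<bullet> (y - A *v ls_estimator A y)"
    by (simp add: w_def inner_diff_right)
  also have "\<dots> = 0"
    using w ls_residual_orthogonal[OF assms(1)] ls_residual_orthogonal[OF assms(2)] eq by simp
  finally show ?thesis
    by (simp add: w_def)
qed

section \<open>Adjusted tests\<close>

theorem proposition5p23:
  fixes X :: "real^'k^'n"
    and R :: "real^'k^'q"
    and r :: "real^'q"
    and C :: "(real^'n^'n) set"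
    and \<mu>\<^sub>0 :: "real^'n"
    and B :: "real^'p^'n"
  assumes "CARD('k) < CARD('n)"
    and "rank X = CARD('k)"
    and "rank R = CARD('q)"
    and "covariance_model C"
    and "\<mu>\<^sub>0 \<in> restricted_space X R r"
    and "span (J_set C) \<inter> col_space X \<subseteq> restricted_space_diff X R r \<mu>\<^sub>0"
    and "admissible_extension C X R r \<mu>\<^sub>0 B"
    and "CARD('k) < CARD('k) + CARD('p)" and "CARD('k) + CARD('p) < CARD('n)"
  shows
    "(\<forall>(\<theta> :: real^'n \<Rightarrow> real^('k + 'p)) (\<Omega> :: real^'n \<Rightarrow> real^'q^'q) N.
        regular_equivariant_pair (append_cols X B) N \<theta> \<Omega> \<longrightarrow>
        regular_equivariant_pair X N (first_block \<theta>) \<Omega> \<and>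
        (\<forall>y. \<forall>z \<in> J_set C.
           test_statistic R r N (first_block \<theta>) \<Omega> (y + z)
             = test_statistic R r N (first_block \<theta>) \<Omega> y))
     \<and>
     (invertible (transpose (append_cols X B) ** append_cols X B) \<and>
      exceptional_set (append_cols X B) {} \<and>
      regular_equivariant_estimator (append_cols X B) {} (ls_estimator (append_cols X B)) \<and>
      (\<forall>z \<in> span (J_set C). R *v first_block (ls_estimator (append_cols X B)) z = 0) \<and>
      (\<forall>B' :: real^'p^'n. admissible_extension C X R r \<mu>\<^sub>0 B' \<longrightarrow>
        (\<forall>y. R *v first_block (ls_estimator (append_cols X B)) y
             = R *v first_block (ls_estimator (append_cols X B')) y)))"
proof -
  let ?A = "append_cols X B"
  let ?L = "span (J_set C \<union> restricted_space_diff X R r \<mu>\<^sub>0)"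
  have injX: "inj ((*v) X)"
    using assms(2) by (simp add: full_rank_injective)
  have inj: "inj ((*v) (append_cols X B'))"
    and span: "col_space (append_cols X B') = M_bar C X"
    and cols: "column i B' \<in> ?L"
    if "admissible_extension C X R r \<mu>\<^sub>0 B'" for B' :: "real^'p^'n" and i
    using that columns_basis_inj
    by (auto simp: admissible_extension_def columns_basis_def col_space_def)
  note ext = assms(7)
  have vanish: "R *v g = 0" if "X *v g + B *v h \<in> ?L" for g h
    using restriction_vanishes_on_enlarged_span[OF injX assms(5,6) cols[OF ext] that] .
  have J_coeffs: "\<exists>\<gamma>. z = ?A *v \<gamma> \<and> R *v (\<chi> a. \<gamma> $ Inl a) = 0" if "z \<in> span (J_set C)" for z
  proof -
    have "z \<in> col_space ?A"
      using that span_mono[of "J_set C" "J_set C \<union> col_space X"]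
      by (auto simp: span[OF ext] M_bar_def)
    then obtain \<gamma> where \<gamma>: "z = ?A *v \<gamma>"
      by (auto simp: col_space_eq_range)
    moreover have "z \<in> ?L"
      using that span_mono[of "J_set C" "J_set C \<union> restricted_space_diff X R r \<mu>\<^sub>0"] by auto
    ultimately show ?thesis
      using vanish by (auto simp: append_cols_mult)
  qed
  have item1: "regular_equivariant_pair X N (first_block \<theta>) \<Omega> \<and>
      (\<forall>y. \<forall>z \<in> J_set C.
         test_statistic R r N (first_block \<theta>) \<Omega> (y + z)
           = test_statistic R r N (first_block \<theta>) \<Omega> y)"
    if pair: "regular_equivariant_pair ?A N \<theta> \<Omega>"
    for \<theta> :: "real^'n \<Rightarrow> real^('k + 'p)" and \<Omega> :: "real^'n \<Rightarrow> real^'q^'q" and N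
  proof (intro conjI allI ballI)
    show "regular_equivariant_pair X N (first_block \<theta>) \<Omega>"
      using assms(2) pair by (rule regular_equivariant_pair_first_block)
    fix y z assume "z \<in> J_set C"
    then obtain \<gamma> where "z = ?A *v \<gamma>" "R *v (\<chi> a. \<gamma> $ Inl a) = 0"
      using J_coeffs span_base by blast
    then show "test_statistic R r N (first_block \<theta>) \<Omega> (y + z)
        = test_statistic R r N (first_block \<theta>) \<Omega> y"
      using test_statistic_shift_invariant[OF pair] by simp
  qed
  have on_J: "R *v first_block (ls_estimator ?A) z = 0" if "z \<in> span (J_set C)" for z
    using J_coeffs[OF that]
    by (auto simp: first_block_def head_block_mult ls_estimator_fitted[OF inj[OF ext]])
  have unique: "R *v first_block (ls_estimator ?A) y
      = R *v first_block (ls_estimator (append_cols X B')) y"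
    if ext': "admissible_extension C X R r \<mu>\<^sub>0 B'" for B' :: "real^'p^'n" and y
  proof -
    define \<gamma> where "\<gamma> = ls_estimator ?A y"
    define \<gamma>' where "\<gamma>' = ls_estimator (append_cols X B') y"
    define g where "g = (\<chi> a. \<gamma> $ Inl a) - (\<chi> a. \<gamma>' $ Inl a)"
    have "?A *v \<gamma> = append_cols X B' *v \<gamma>'"
      unfolding \<gamma>_def \<gamma>'_def
      using inj[OF ext] inj[OF ext'] by (rule ls_fit_depends_on_col_space) (simp add: span ext ext')
    then have "X *v g + B *v (\<chi> b. \<gamma> $ Inr b) = B' *v (\<chi> b. \<gamma>' $ Inr b)"
      by (simp add: append_cols_mult g_def matrix_vector_mult_diff_distrib algebra_simps)
    also have "\<dots> \<in> ?L"
      unfolding matrix_mult_sum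
      by (intro span_sum) (auto simp: scalar_mult_eq_scaleR intro: span_scale cols[OF ext'])
    finally have "R *v g = 0"
      by (rule vanish)
    then show ?thesis
      by (simp add: first_block_def head_block_mult g_def matrix_vector_mult_diff_distrib
          \<gamma>_def[symmetric] \<gamma>'_def[symmetric])
  qed
  have "exceptional_set ?A {}"
    by (simp add: exceptional_set_def)
  then show ?thesis
    using item1 on_J unique gram_invertible[OF inj[OF ext]] ls_regular_equivariant[OF inj[OF ext]]
    by blast
qed

end
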